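(* Let $\#$ be the two-variable geometric mean and let $M_{\#,\#,\#}$ be the three-variable operator mean on $B(\mathcal H)_+$ obtained from it by the ALM-procedure. Then $(M_{\#,\#,\#})^*=M_{\#,\#,\#}$; that is, $M_{\#,\#,\#}$ is its own adjoint: $$M_{\#,\#,\#}(A,B,C)=M_{\#,\#,\#}(A^{-1},B^{-1},C^{-1})^{-1}$$ for all invertible positive operators $A,B,C$ on $\mathcal H$.
   Context: $\mathcal H$ is a Hilbert space (of arbitrary dimension), $B(\mathcal H)_+$ the set of positive (semidefinite) bounded operators. The geometric mean is $A\#B=A^{1/2}(A^{-1/2}BA^{-1/2})^{1/2}A^{1/2}$ for $A$ positive invertible and $B\ge 0$, and in general $A\#B$ is the strong limit of $(A+\varepsilon I)\#(B+\varepsilon I)$ as $\varepsilon\downarrow0$. For $A,B,C\in B(\mathcal H)_+$ define $(A_0,B_0,C_0)=(A,B,C)$ and $(A_{n+1},B_{n+1},C_{n+1})=(B_n\#C_n,\;C_n\#A_n,\;A_n\#B_n)$. These three sequences converge in the weak operator topology to a common limit, denoted $M_{\#,\#,\#}(A,B,C)$; it is invertible when $A,B,C$ are. For multivariate operator means $M_1,M_2$, $M_2$ is called the adjoint of $M_1$, written $M_2=M_1^*$, if $M_2(A_1,\ldots,A_n)=M_1(A_1^{-1},\ldots,A_n^{-1})^{-1}$ for all invertible positive operators $A_1,\ldots,A_n$ (it is unique if it exists). *)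

theory Defs
  imports "HOL-Analysis.Analysis"
begin

section \<open>Complex Hilbert spaces\<close>

text \<open>The real structure (addition, \<open>scaleR\<close>, norm, completeness) is inherited from the
  library classes; the real inner product is the real part of the complex one, so that
  \<open>norm x\<close> is the square root of \<open>cinner x x\<close>. Positive definiteness of \<open>cinner\<close> then
  follows from that of \<open>inner\<close>, see \<open>cinner_self\<close>.
  \<open>cinner\<close> is linear in its first argument. No dimension restriction is imposed.\<close>

class complex_hilbert_space = real_inner + banach +
  fixes scaleC :: "complex \<Rightarrow> 'a \<Rightarrow> 'a"
    and cinner :: "'a \<Rightarrow> 'a \<Rightarrow> complex"
  assumes scaleC_add_right: "scaleC a (x + y) = scaleC a x + scaleC a y"
    and scaleC_add_left: "scaleC (a + b) x = scaleC a x + scaleC b x"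
    and scaleC_scaleC: "scaleC a (scaleC b x) = scaleC (a * b) x"
    and scaleC_of_real: "scaleC (complex_of_real r) x = scaleR r x"
    and cinner_commute: "cinner x y = cnj (cinner y x)"
    and cinner_add_left: "cinner (x + y) z = cinner x z + cinner y z"
    and cinner_scaleC_left: "cinner (scaleC a x) y = a * cinner x y"
    and inner_eq_Re_cinner: "inner x y = Re (cinner x y)"

lemma cinner_self: "cinner x x = complex_of_real ((norm x)\<^sup>2)"
proof (rule complex_eqI)
  show "Re (cinner x x) = Re (complex_of_real ((norm x)\<^sup>2))"
    by (simp add: power2_norm_eq_inner inner_eq_Re_cinner)
  have "Im (cinner x x) = - Im (cinner x x)"
    using arg_cong[OF cinner_commute[of x x], of Im] by simp
  then show "Im (cinner x x) = Im (complex_of_real ((norm x)\<^sup>2))" by simp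
qed

instantiation complex :: complex_hilbert_space
begin

definition scaleC_complex :: "complex \<Rightarrow> complex \<Rightarrow> complex" where
  "scaleC_complex a x = a * x"

definition cinner_complex :: "complex \<Rightarrow> complex \<Rightarrow> complex" where
  "cinner_complex x y = x * cnj y"

instance
  by standard (auto simp: scaleC_complex_def cinner_complex_def algebra_simps
      scaleR_conv_of_real inner_complex_def)

end

section \<open>Bounded operators\<close>

text \<open>Elements of \<open>'a \<Rightarrow>\<^sub>L 'a\<close> are only real-linear; those that belong to
  $B(\mathcal H)$ are singled out by \<open>complex_linear\<close>. Since the space is complex,
  self-adjointness of a positive operator is automatic.\<close>

definition complex_linear :: "('a::complex_hilbert_space \<Rightarrow>\<^sub>L 'a) \<Rightarrow> bool" where
  "complex_linear T \<longleftrightarrow> (\<forall>c x. T (scaleC c x) = scaleC c (T x))"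

definition positive_op :: "('a::complex_hilbert_space \<Rightarrow>\<^sub>L 'a) \<Rightarrow> bool" where
  "positive_op T \<longleftrightarrow> complex_linear T \<and> (\<forall>x. cinner (T x) x \<in> \<real>\<^sub>\<ge>\<^sub>0)"

definition is_inverse_op ::
    "('a::real_normed_vector \<Rightarrow>\<^sub>L 'a) \<Rightarrow> ('a \<Rightarrow>\<^sub>L 'a) \<Rightarrow> bool" where
  "is_inverse_op T S \<longleftrightarrow> T o\<^sub>L S = id_blinfun \<and> S o\<^sub>L T = id_blinfun"

definition invertible_op :: "('a::real_normed_vector \<Rightarrow>\<^sub>L 'a) \<Rightarrow> bool" where
  "invertible_op T \<longleftrightarrow> (\<exists>S. is_inverse_op T S)"

definition inverse_op :: "('a::real_normed_vector \<Rightarrow>\<^sub>L 'a) \<Rightarrow> ('a \<Rightarrow>\<^sub>L 'a)" where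
  "inverse_op T = (THE S. is_inverse_op T S)"

lemma inverse_op_eqI:
  assumes "is_inverse_op T S"
  shows "inverse_op T = S"
  unfolding inverse_op_def
proof (rule the_equality[where P = "is_inverse_op T", OF assms])
  fix R assume "is_inverse_op T R"
  then have "R = R o\<^sub>L (T o\<^sub>L S)" "(R o\<^sub>L T) o\<^sub>L S = S"
    using assms by (simp_all add: is_inverse_op_def blinfun_eqI)
  moreover have "R o\<^sub>L (T o\<^sub>L S) = (R o\<^sub>L T) o\<^sub>L S"
    by (rule blinfun_eqI) simp
  ultimately show "R = S" by simp
qed

definition sqrt_op :: "('a::complex_hilbert_space \<Rightarrow>\<^sub>L 'a) \<Rightarrow> ('a \<Rightarrow>\<^sub>L 'a)" where
  "sqrt_op T = (THE S. positive_op S \<and> S o\<^sub>L S = T)"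

text \<open>The library provides \<open>strong_operator_topology\<close>; the weak one is its analogue with the
  maps \<open>T \<mapsto> cinner (T x) y\<close> in place of \<open>T \<mapsto> T x\<close>.\<close>

definition weak_operator_topology :: "('a::complex_hilbert_space \<Rightarrow>\<^sub>L 'a) topology" where
  "weak_operator_topology = 
    pullback_topology UNIV (\<lambda>T (x, y). cinner (blinfun_apply T x) y) euclidean"

lemma limitin_weak_operator_topology:
  "limitin weak_operator_topology f T F \<longleftrightarrow>
    (\<forall>x y. ((\<lambda>i. cinner (f i x) y) \<longlongrightarrow> cinner (T x) y) F)"
proof -
  define \<phi> :: "('a \<Rightarrow>\<^sub>L 'a) \<Rightarrow> 'a \<times> 'a \<Rightarrow> complex"
    where "\<phi> = (\<lambda>T (x, y). cinner (blinfun_apply T x) y)"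
  have "limitin weak_operator_topology f T F \<longleftrightarrow> limitin euclidean (\<phi> \<circ> f) (\<phi> T) F"
    unfolding weak_operator_topology_def \<phi>_def[symmetric] limitin_def
      topspace_pullback_topology openin_pullback_topology by auto
  also have "\<dots> \<longleftrightarrow> (\<forall>p. limitin euclidean (\<lambda>i. \<phi> (f i) p) (\<phi> T p) F)"
    unfolding euclidean_product_topology[symmetric] limitin_componentwise by auto
  finally show ?thesis by (simp add: \<phi>_def)
qed

section \<open>The geometric mean and the ALM procedure\<close>

definition geometric_mean_inv ::
    "('a::complex_hilbert_space \<Rightarrow>\<^sub>L 'a) \<Rightarrow> ('a \<Rightarrow>\<^sub>L 'a) \<Rightarrow> ('a \<Rightarrow>\<^sub>L 'a)" where
  "geometric_mean_inv A B =
    (let R = sqrt_op A; R' = inverse_op R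
     in R o\<^sub>L sqrt_op (R' o\<^sub>L B o\<^sub>L R') o\<^sub>L R)"

definition geometric_mean ::
    "('a::complex_hilbert_space \<Rightarrow>\<^sub>L 'a) \<Rightarrow> ('a \<Rightarrow>\<^sub>L 'a) \<Rightarrow> ('a \<Rightarrow>\<^sub>L 'a)"
    (infixl \<open>\<sharp>\<close> 70) where
  "A \<sharp> B =
    (if invertible_op A then geometric_mean_inv A B
     else THE G. limitin strong_operator_topology
       (\<lambda>\<epsilon>::real. geometric_mean_inv (A + \<epsilon> *\<^sub>R id_blinfun) (B + \<epsilon> *\<^sub>R id_blinfun))
       G (at_right 0))"

primrec alm_seq ::
    "('a::complex_hilbert_space \<Rightarrow>\<^sub>L 'a) \<Rightarrow> ('a \<Rightarrow>\<^sub>L 'a) \<Rightarrow> ('a \<Rightarrow>\<^sub>L 'a) \<Rightarrow> nat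
      \<Rightarrow> ('a \<Rightarrow>\<^sub>L 'a) \<times> ('a \<Rightarrow>\<^sub>L 'a) \<times> ('a \<Rightarrow>\<^sub>L 'a)" where
  "alm_seq A B C 0 = (A, B, C)"
| "alm_seq A B C (Suc n) =
    (case alm_seq A B C n of (X, Y, Z) \<Rightarrow> (Y \<sharp> Z, Z \<sharp> X, X \<sharp> Y))"

definition alm_mean ::
    "('a::complex_hilbert_space \<Rightarrow>\<^sub>L 'a) \<Rightarrow> ('a \<Rightarrow>\<^sub>L 'a) \<Rightarrow> ('a \<Rightarrow>\<^sub>L 'a) \<Rightarrow> ('a \<Rightarrow>\<^sub>L 'a)" where
  "alm_mean A B C = (THE M.
     limitin weak_operator_topology (\<lambda>n. fst (alm_seq A B C n)) M sequentially \<and>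
     limitin weak_operator_topology (\<lambda>n. fst (snd (alm_seq A B C n))) M sequentially \<and>
     limitin weak_operator_topology (\<lambda>n. snd (snd (alm_seq A B C n))) M sequentially)"

text \<open>\<open>is_adjoint_mean M\<^sub>2 M\<^sub>1\<close> reads $M_2 = M_1^*$ (for three variables). The outer
  inverse must make sense, so its existence is part of the definition; otherwise
  \<open>inverse_op\<close> would return an unspecified operator.\<close>

definition is_adjoint_mean ::
    "(('a::complex_hilbert_space \<Rightarrow>\<^sub>L 'a) \<Rightarrow> ('a \<Rightarrow>\<^sub>L 'a) \<Rightarrow> ('a \<Rightarrow>\<^sub>L 'a) \<Rightarrow> ('a \<Rightarrow>\<^sub>L 'a))
      \<Rightarrow> (('a \<Rightarrow>\<^sub>L 'a) \<Rightarrow> ('a \<Rightarrow>\<^sub>L 'a) \<Rightarrow> ('a \<Rightarrow>\<^sub>L 'a) \<Rightarrow> ('a \<Rightarrow>\<^sub>L 'a)) \<Rightarrow> bool" where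
  "is_adjoint_mean M\<^sub>2 M\<^sub>1 \<longleftrightarrow>
    (\<forall>A B C. positive_op A \<and> invertible_op A \<and> positive_op B \<and> invertible_op B \<and>
        positive_op C \<and> invertible_op C \<longrightarrow>
      invertible_op (M\<^sub>1 (inverse_op A) (inverse_op B) (inverse_op C)) \<and>
      M\<^sub>2 A B C = inverse_op (M\<^sub>1 (inverse_op A) (inverse_op B) (inverse_op C)))"

end

theory Submission
  imports Defs
begin

text \<open>On positive invertible operators, \<open>G = A \<sharp> B\<close> is the only positive solution of the Riccati
  equation $G A^{-1} G = B$. This yields symmetry, homogeneity and self-duality
  $(A \sharp B)^{-1} = A^{-1} \sharp B^{-1}$ of the geometric mean, and monotonicity of the square root
  makes it monotone. If $X \le (1+e) Y$ for all ordered pairs of the three operators, then after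
  one ALM step the same holds with $e/2$, while bounds $kI \le X \le KI$ persist. Hence the ALM
  sequences are Cauchy in operator norm, with a common limit. By self-duality the ALM sequences of
  the inverses consist of the inverses; norm convergence of both lets one pass to the limit
  in $X_n X_n^{-1} = I$, which would not be possible with weak convergence.\<close>

section \<open>The complex structure\<close>

lemma cinner_add_right: "cinner x (y + z) = cinner x y + cinner x z"
  by (subst (1 2 3) cinner_commute) (simp add: cinner_add_left)

lemma cinner_scaleC_right: "cinner x (scaleC c y) = cnj c * cinner x y"
  by (subst (1 2) cinner_commute) (simp add: cinner_scaleC_left)

text \<open>Multiplying the second argument by \<open>\<i>\<close> moves the imaginary part into the
  real one. Reality and limits of complex inner products thereby reduce to the real inner
  product.\<close>

lemma cinner_eq_inner: "cinner x y = Complex (inner x y) (inner x (scaleC \<i> y))"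
  by (simp add: complex_eq_iff inner_eq_Re_cinner cinner_scaleC_right)

lemma norm_scaleC: "norm (scaleC c x) = cmod c * norm x"
proof -
  have "cinner (scaleC c x) (scaleC c x) = c * cnj c * cinner x x"
    by (simp add: cinner_scaleC_left cinner_scaleC_right)
  also have "\<dots> = complex_of_real ((cmod c * norm x)\<^sup>2)"
    by (simp add: cinner_self complex_norm_square[symmetric] power_mult_distrib)
  finally have "(norm (scaleC c x))\<^sup>2 = (cmod c * norm x)\<^sup>2"
    by (simp only: cinner_self of_real_eq_iff)
  then show ?thesis by (simp add: power2_eq_iff_nonneg)
qed

lemma scaleC_scaleR: "scaleC c (scaleR r x) = scaleR r (scaleC c x)"
  by (simp add: scaleC_of_real[symmetric] scaleC_scaleC mult.commute)

lemma bounded_linear_scaleC: "bounded_linear (scaleC c)"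
  by (rule bounded_linear_intro[where K = "cmod c"])
     (simp_all add: scaleC_add_right scaleC_scaleR norm_scaleC mult.commute)

lemma complex_linear_zero: "complex_linear 0"
  by (simp add: complex_linear_def linear_0[OF bounded_linear.linear[OF bounded_linear_scaleC]])

lemma complex_linear_id: "complex_linear id_blinfun"
  by (simp add: complex_linear_def)

lemma complex_linear_add:
  "complex_linear S \<Longrightarrow> complex_linear T \<Longrightarrow> complex_linear (S + T)"
  by (simp add: complex_linear_def blinfun.add_left scaleC_add_right)

lemma complex_linear_scaleR: "complex_linear T \<Longrightarrow> complex_linear (r *\<^sub>R T)"
  by (simp add: complex_linear_def blinfun.scaleR_left scaleC_scaleR)

lemma complex_linear_diff:
  "complex_linear S \<Longrightarrow> complex_linear T \<Longrightarrow> complex_linear (S - T)"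
  using complex_linear_add[of S "(-1) *\<^sub>R T"] complex_linear_scaleR[of T "-1"] by simp

lemma complex_linear_compose:
  "complex_linear S \<Longrightarrow> complex_linear T \<Longrightarrow> complex_linear (S o\<^sub>L T)"
  by (simp add: complex_linear_def)

section \<open>Symmetric operators and the Loewner order\<close>

text \<open>Phrased with the real inner product, so that the order theory runs in real spaces. For
  complex linear operators it amounts to self-adjointness, because testing against
  \<open>scaleC \<i> y\<close> recovers the imaginary part.\<close>

definition symmetric_op :: "('a::real_inner \<Rightarrow>\<^sub>L 'a) \<Rightarrow> bool" where
  "symmetric_op T \<longleftrightarrow> (\<forall>x y. inner (T x) y = inner x (T y))"

text \<open>Only quadratic forms are compared, which gives a preorder; antisymmetry holds on
  symmetric operators (\<open>loewner_antisym\<close>).\<close>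

definition loewner_le :: "('a::real_inner \<Rightarrow>\<^sub>L 'a) \<Rightarrow> ('a \<Rightarrow>\<^sub>L 'a) \<Rightarrow> bool"
    (infix \<open>\<preceq>\<close> 50) where
  "S \<preceq> T \<longleftrightarrow> (\<forall>x. inner (S x) x \<le> inner (T x) x)"

lemma symmetric_opD: "symmetric_op T \<Longrightarrow> inner (T x) y = inner x (T y)"
  by (simp add: symmetric_op_def)

lemma symmetric_op_id: "symmetric_op id_blinfun"
  by (simp add: symmetric_op_def)

lemma symmetric_op_zero: "symmetric_op 0"
  by (simp add: symmetric_op_def)

lemma symmetric_op_add: "symmetric_op S \<Longrightarrow> symmetric_op T \<Longrightarrow> symmetric_op (S + T)"
  by (simp add: symmetric_op_def blinfun.add_left inner_add_left inner_add_right)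

lemma symmetric_op_diff: "symmetric_op S \<Longrightarrow> symmetric_op T \<Longrightarrow> symmetric_op (S - T)"
  by (simp add: symmetric_op_def blinfun.diff_left inner_diff_left inner_diff_right)

lemma symmetric_op_scaleR: "symmetric_op T \<Longrightarrow> symmetric_op (r *\<^sub>R T)"
  by (simp add: symmetric_op_def blinfun.scaleR_left)

lemma symmetric_op_square: "symmetric_op T \<Longrightarrow> symmetric_op (T o\<^sub>L T)"
  by (simp add: symmetric_op_def)

lemma loewner_le_refl: "T \<preceq> T"
  by (simp add: loewner_le_def)

lemma loewner_le_trans [trans]: "R \<preceq> S \<Longrightarrow> S \<preceq> T \<Longrightarrow> R \<preceq> T"
  unfolding loewner_le_def by (meson order_trans)

lemma loewner_le_scaleR: "S \<preceq> T \<Longrightarrow> 0 \<le> r \<Longrightarrow> r *\<^sub>R S \<preceq> r *\<^sub>R T"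
  by (simp add: loewner_le_def blinfun.scaleR_left mult_left_mono)

lemma loewner_le_scaleR_left: "0 \<preceq> T \<Longrightarrow> r \<le> s \<Longrightarrow> r *\<^sub>R T \<preceq> s *\<^sub>R T"
  by (simp add: loewner_le_def blinfun.scaleR_left mult_right_mono)

lemma loewner_le_congruence:
  assumes "symmetric_op R" "S \<preceq> T"
  shows "R o\<^sub>L S o\<^sub>L R \<preceq> R o\<^sub>L T o\<^sub>L R"
  using assms by (simp add: loewner_le_def symmetric_opD[OF assms(1)])

section \<open>Operator norm and quadratic form\<close>

lemma loewner_le_norm: "T \<preceq> norm T *\<^sub>R id_blinfun"
proof -
  have "inner (T x) x \<le> norm T * inner x x" for x
  proof -
    have "inner (T x) x \<le> norm (T x) * norm x" by (rule norm_cauchy_schwarz)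
    also have "\<dots> \<le> norm T * norm x * norm x"
      by (intro mult_right_mono norm_blinfun) simp
    finally show ?thesis by (simp add: dot_square_norm power2_eq_square mult.assoc)
  qed
  then show ?thesis by (simp add: loewner_le_def blinfun.scaleR_left)
qed

text \<open>Polarisation and the parallelogram law bound <Tx, y>. Taking y parallel to Tx with the
  norm of x turns <Tx, y> into the product of the norms of x and Tx.\<close>

lemma norm_le_quadratic_form:
  assumes sym: "symmetric_op T" and a: "0 \<le> a"
    and bd: "\<And>x. \<bar>inner (T x) x\<bar> \<le> a * (norm x)\<^sup>2"
  shows "norm T \<le> a"
proof (rule norm_blinfun_bound[OF a])
  fix x
  show "norm (T x) \<le> a * norm x"
  proof (cases "x = 0 \<or> T x = 0")
    case True
    then show ?thesis using a by auto
  next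
    case False
    define s where "s = norm x / norm (T x)"
    define y where "y = s *\<^sub>R T x"
    have ny: "norm y = norm x" using False by (simp add: y_def s_def)
    have "4 * inner (T x) y = inner (T (x + y)) (x + y) - inner (T (x - y)) (x - y)"
      using symmetric_opD[OF sym, of y x]
      by (simp add: blinfun.add_right blinfun.diff_right inner_add_left inner_add_right
          inner_diff_left inner_diff_right inner_commute)
    also have "\<dots> \<le> a * (norm (x + y))\<^sup>2 + a * (norm (x - y))\<^sup>2"
      using bd[of "x + y"] bd[of "x - y"] by linarith
    also have "\<dots> = a * (2 * (norm x)\<^sup>2 + 2 * (norm y)\<^sup>2)"
      by (simp add: power2_norm_eq_inner inner_add_left inner_add_right
          inner_diff_left inner_diff_right algebra_simps)
    finally have "inner (T x) y \<le> a * (norm x)\<^sup>2" by (simp add: ny)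
    moreover have "inner (T x) y = norm x * norm (T x)"
      using False by (simp add: y_def s_def dot_square_norm power2_eq_square)
    ultimately show ?thesis using False by (simp add: power2_eq_square)
  qed
qed

lemma norm_apply_squared_le:
  assumes sym: "symmetric_op T" and pos: "0 \<preceq> T"
  shows "(norm (T x))\<^sup>2 \<le> norm T * inner (T x) x"
proof (cases "norm T = 0")
  case True
  then show ?thesis by simp
next
  case False
  \<comment> \<open>This t minimises the bound -2t ||Tx||^2 + t^2 ||T|| ||Tx||^2 obtained
    below.\<close>
  define t where "t = 1 / norm T"
  have t: "t > 0" "t * norm T = 1" using False by (simp_all add: t_def)
  let ?u = "T x"
  have "0 \<le> inner (T (x - t *\<^sub>R ?u)) (x - t *\<^sub>R ?u)"
    using pos by (simp add: loewner_le_def)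
  also have "\<dots> = inner (T x) x - 2 * t * (norm ?u)\<^sup>2 + t * t * inner (T ?u) ?u"
    using symmetric_opD[OF sym, of "?u" x]
    by (simp add: blinfun.diff_right blinfun.scaleR_right inner_diff_left inner_diff_right
        power2_norm_eq_inner algebra_simps)
  also have "\<dots> \<le> inner (T x) x - 2 * t * (norm ?u)\<^sup>2 + t * t * (norm T * (norm ?u)\<^sup>2)"
    using loewner_le_norm[of T]
    by (auto simp: loewner_le_def blinfun.scaleR_left power2_norm_eq_inner
        intro!: mult_left_mono)
  also have "\<dots> = inner (T x) x - t * (norm ?u)\<^sup>2"
    using t(2) by (simp add: algebra_simps)
  finally have "norm T * (t * (norm ?u)\<^sup>2) \<le> norm T * inner (T x) x"
    by (intro mult_left_mono) auto
  then show ?thesis using t(2) by (simp add: mult.assoc[symmetric] mult.commute)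
qed

lemma norm_le_of_loewner:
  assumes "symmetric_op T" "0 \<le> a" "(- a) *\<^sub>R id_blinfun \<preceq> T" "T \<preceq> a *\<^sub>R id_blinfun"
  shows "norm T \<le> a"
proof (rule norm_le_quadratic_form[OF assms(1,2)])
  fix x
  show "\<bar>inner (T x) x\<bar> \<le> a * (norm x)\<^sup>2"
    using assms(3,4)[unfolded loewner_le_def, rule_format, of x]
    by (simp add: blinfun.scaleR_left blinfun.minus_left power2_norm_eq_inner abs_le_iff)
qed

lemma loewner_antisym:
  assumes "symmetric_op S" "symmetric_op T" "S \<preceq> T" "T \<preceq> S"
  shows "S = T"
proof -
  have "norm (S - T) \<le> 0"
    using assms by (intro norm_le_of_loewner symmetric_op_diff)
      (auto simp: loewner_le_def blinfun.diff_left inner_diff_left)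
  then show ?thesis by simp
qed

text \<open>If \<open>m < 0\<close> is the infimum of the quadratic form of \<open>X\<close> on the unit sphere, then an
  approximate eigenvector for \<open>m\<close> violates the assumption on $\langle Xx, Px\rangle$.\<close>

lemma loewner_nonneg_of_Lyapunov:
  fixes X P :: "'a::real_inner \<Rightarrow>\<^sub>L 'a"
  assumes sX: "symmetric_op X"
    and c: "0 < c" and P: "c *\<^sub>R id_blinfun \<preceq> P"
    and XP: "\<And>x. 0 \<le> inner (X x) (P x)"
  shows "0 \<preceq> X"
proof (rule ccontr)
  assume "\<not> 0 \<preceq> X"
  then obtain x0 where x0: "inner (X x0) x0 < 0" by (auto simp: loewner_le_def not_le)
  then have x0n: "norm x0 > 0" by auto
  define Q where "Q = {inner (X x) x |x. norm x = 1}"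
  have bdd: "bdd_below Q"
  proof
    fix q assume "q \<in> Q"
    then obtain x where x: "q = inner (X x) x" "norm x = 1" by (auto simp: Q_def)
    have "\<bar>q\<bar> \<le> norm (X x) * norm x" unfolding x(1) by (rule Cauchy_Schwarz_ineq2)
    also have "\<dots> \<le> norm X" using norm_blinfun[of X x] x(2) by simp
    finally show "- norm X \<le> q" by linarith
  qed
  define u where "u = (1 / norm x0) *\<^sub>R x0"
  have u: "norm u = 1" "inner (X u) u < 0"
    using x0n x0 by (auto simp: u_def blinfun.scaleR_right divide_less_0_iff)
  have uQ: "inner (X u) u \<in> Q" using u by (auto simp: Q_def)
  define m where "m = Inf Q"
  have m: "m < 0" using cInf_lower[OF uQ bdd] u(2) by (simp add: m_def)
  \<comment> \<open>Subtracting the infimum makes the form nonnegative, so that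
    \<open>norm_apply_squared_le\<close> applies to \<open>Z\<close>.\<close>
  define Z where "Z = X - m *\<^sub>R id_blinfun"
  have sZ: "symmetric_op Z"
    unfolding Z_def by (intro symmetric_op_diff symmetric_op_scaleR symmetric_op_id sX)
  have Zunit: "inner (Z x) x = inner (X x) x - m" if "norm x = 1" for x
    using that by (simp add: Z_def blinfun.diff_left blinfun.scaleR_left inner_diff_left
        dot_square_norm)
  have "0 \<le> inner (Z x) x" for x
  proof (cases "x = 0")
    case False
    define v where "v = (1 / norm x) *\<^sub>R x"
    have v: "norm v = 1" using False by (simp add: v_def)
    have "inner (X v) v \<in> Q" using v by (auto simp: Q_def)
    then have "0 \<le> inner (Z v) v" using cInf_lower[OF _ bdd] Zunit[OF v] by (simp add: m_def)
    moreover have "inner (Z x) x = (norm x)\<^sup>2 * inner (Z v) v"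
      using False by (simp add: v_def blinfun.scaleR_right power2_eq_square)
    ultimately show ?thesis by simp
  qed simp
  then have pZ: "0 \<preceq> Z" by (simp add: loewner_le_def)
  define d where "d = - m * c"
  have d: "0 < d" using m c by (simp add: d_def mult_less_0_iff)
  \<comment> \<open>With X = Z + mI and m < 0, the assumption on <Xx, Px> keeps Zx away from 0 on
    the unit sphere.\<close>
  have low: "d \<le> norm (Z x) * norm P" if x: "norm x = 1" for x
  proof -
    have "0 \<le> inner (X x) (P x)" by (rule XP)
    also have "\<dots> = inner (Z x) (P x) + m * inner (P x) x"
      by (simp add: Z_def blinfun.diff_left blinfun.scaleR_left inner_diff_left
          inner_commute[of "P x" x])
    also have "inner (Z x) (P x) \<le> norm (Z x) * norm (P x)" by (rule norm_cauchy_schwarz)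
    also have "norm (Z x) * norm (P x) \<le> norm (Z x) * norm P"
      using norm_blinfun[of P x] x by (intro mult_left_mono) auto
    also have "m * inner (P x) x \<le> m * c"
      using P[unfolded loewner_le_def, rule_format, of x] x m
      by (intro mult_left_mono_neg) (auto simp: blinfun.scaleR_left dot_square_norm)
    finally show ?thesis by (simp add: d_def)
  qed
  have nP: "norm P > 0" using low[OF u(1)] d by (auto simp: less_le)
  have nZ: "norm Z > 0" using low[OF u(1)] d by (auto simp: less_le)
  \<comment> \<open>By \<open>norm_apply_squared_le\<close> the lower bound on ||Zx|| becomes the
    lower bound \<open>e\<close> on the form of \<open>Z\<close>. The form of \<open>X\<close> is
    then at least m + e on the unit sphere, against the choice of m as its infimum.\<close>
  define e where "e = (d / norm P)\<^sup>2 / norm Z"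
  have e: "e > 0" using d nP nZ by (simp add: e_def)
  have "m + e \<le> q" if q: "q \<in> Q" for q
  proof -
    obtain x where x: "q = inner (X x) x" "norm x = 1" using q by (auto simp: Q_def)
    have "(d / norm P)\<^sup>2 \<le> (norm (Z x))\<^sup>2"
      using low[OF x(2)] nP d by (intro power_mono) (auto simp: divide_le_eq)
    also have "\<dots> \<le> norm Z * inner (Z x) x" by (rule norm_apply_squared_le[OF sZ pZ])
    finally have "e \<le> inner (Z x) x" using nZ by (simp add: e_def divide_le_eq mult.commute)
    then show ?thesis using Zunit[OF x(2)] x(1) by simp
  qed
  then have "m + e \<le> m"
    unfolding m_def using uQ by (intro cInf_greatest) auto
  then show False using e by simp
qed

text \<open>By symmetry the cross terms of <(T - S)x, (T + S)x> cancel even if S and T do not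
  commute, which leaves the form of T^2 - S^2. The previous lemma then applies with X = T - S and P
  = T + S.\<close>

lemma loewner_le_of_square_le:
  assumes sS: "symmetric_op S" and sT: "symmetric_op T" and pS: "0 \<preceq> S"
    and c: "0 < c" and T: "c *\<^sub>R id_blinfun \<preceq> T"
    and le: "S o\<^sub>L S \<preceq> T o\<^sub>L T"
  shows "S \<preceq> T"
proof -
  have "0 \<preceq> T - S"
  proof (rule loewner_nonneg_of_Lyapunov[OF symmetric_op_diff[OF sT sS] c])
    show "c *\<^sub>R id_blinfun \<preceq> T + S"
      unfolding loewner_le_def
    proof
      fix x
      show "inner ((c *\<^sub>R id_blinfun) x) x \<le> inner ((T + S) x) x"
        using T[unfolded loewner_le_def, rule_format, of x]
          pS[unfolded loewner_le_def, rule_format, of x]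
        by (simp add: blinfun.add_left inner_add_left)
    qed
    fix x
    have "inner ((T - S) x) ((T + S) x) = inner (T (T x)) x - inner (S (S x)) x"
      by (simp add: blinfun.add_left blinfun.diff_left inner_add_right inner_diff_left
          symmetric_opD[OF sS, of "S x"] symmetric_opD[OF sT, of "T x"]
          inner_commute[of "S x" "T x"])
    then show "0 \<le> inner ((T - S) x) ((T + S) x)"
      using le by (simp add: loewner_le_def)
  qed
  then show ?thesis by (simp add: loewner_le_def blinfun.diff_left inner_diff_left)
qed

section \<open>Positive operators\<close>

text \<open>Complex scalars force symmetry: reality of the form at x + iy makes the cross terms
  real. The equivalence gives access to the real order theory above.\<close>

lemma positive_op_iff:
  "positive_op T \<longleftrightarrow> complex_linear T \<and> symmetric_op T \<and> 0 \<preceq> T"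
proof (intro iffI conjI)
  assume T: "positive_op T"
  show cl: "complex_linear T" using T by (simp add: positive_op_def)
  have im: "Im (cinner (T x) x) = 0" and re: "0 \<le> Re (cinner (T x) x)" for x
    using T by (auto simp: positive_op_def complex_nonneg_Reals_iff)
  have "0 \<le> inner (T x) x" for x using re[of x] by (simp only: inner_eq_Re_cinner)
  then show "0 \<preceq> T" by (simp add: loewner_le_def)
  show "symmetric_op T" unfolding symmetric_op_def
  proof (intro allI)
    fix x y :: 'a
    let ?z = "scaleC \<i> y"
    have "cinner (T (x + ?z)) (x + ?z) =
      cinner (T x) x + cinner (T ?z) ?z + cinner (T x) ?z + cinner (T ?z) x"
      by (simp add: blinfun.add_right cinner_add_left cinner_add_right)
    from arg_cong[OF this, of Im] have "Im (cinner (T x) ?z + cinner (T ?z) x) = 0"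
      using im by simp
    moreover have "cinner (T ?z) x = \<i> * cinner (T y) x"
      using cl by (simp add: complex_linear_def cinner_scaleC_left)
    ultimately have "Re (cinner (T x) y) = Re (cinner (T y) x)"
      by (simp add: cinner_scaleC_right)
    then show "inner (T x) y = inner x (T y)"
      by (metis inner_commute inner_eq_Re_cinner)
  qed
next
  assume T: "complex_linear T \<and> symmetric_op T \<and> 0 \<preceq> T"
  have "cinner (T x) x \<in> \<real>\<^sub>\<ge>\<^sub>0" for x
  proof -
    \<comment> \<open>\<open>T\<close> commutes with multiplication by \<open>\<i>\<close>, so real
      symmetry makes the complex form equal to its own conjugate.\<close>
    have "inner (T x) (scaleC \<i> x) = inner x (scaleC \<i> (T x))"
      using T by (metis symmetric_opD complex_linear_def)
    then have "Im (cinner (T x) x) = Im (cinner x (T x))"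
      by (simp add: cinner_eq_inner)
    also have "\<dots> = - Im (cinner (T x) x)"
      using arg_cong[OF cinner_commute[of x "T x"], of Im] by simp
    finally have "Im (cinner (T x) x) = 0" by simp
    moreover have "0 \<le> inner (T x) x" using T by (simp add: loewner_le_def)
    ultimately show ?thesis by (simp add: complex_nonneg_Reals_iff inner_eq_Re_cinner)
  qed
  then show "positive_op T" using T by (simp add: positive_op_def)
qed

lemma positive_opD:
  assumes "positive_op T"
  shows "complex_linear T" "symmetric_op T" "0 \<preceq> T"
  using assms by (simp_all add: positive_op_iff)

lemma positive_op_scaleR: "positive_op T \<Longrightarrow> 0 \<le> r \<Longrightarrow> positive_op (r *\<^sub>R T)"
  by (auto simp: positive_op_iff complex_linear_scaleR symmetric_op_scaleR loewner_le_def
      blinfun.scaleR_left)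

lemma positive_op_id: "positive_op id_blinfun"
  by (simp add: positive_op_iff complex_linear_id symmetric_op_id loewner_le_def)

lemma positive_op_congruence:
  assumes "positive_op R" "positive_op T"
  shows "positive_op (R o\<^sub>L T o\<^sub>L R)"
  using assms loewner_le_congruence[of R 0 T]
  by (auto simp: positive_op_iff complex_linear_compose symmetric_op_def loewner_le_def)

section \<open>Inverses and positive invertible operators\<close>

lemma is_inverse_op_inverse_op: "invertible_op T \<Longrightarrow> is_inverse_op T (inverse_op T)"
  unfolding invertible_op_def using inverse_op_eqI by blast

lemma is_inverse_op_iff: "is_inverse_op T S \<longleftrightarrow> (\<forall>x. T (S x) = x \<and> S (T x) = x)"
  unfolding is_inverse_op_def
  by (metis blinfun_apply_blinfun_compose blinfun_apply_id_blinfun blinfun_eqI)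

lemma inverse_op_apply:
  assumes "invertible_op T"
  shows "inverse_op T (T x) = x" "T (inverse_op T x) = x"
  using is_inverse_op_inverse_op[OF assms] by (simp_all add: is_inverse_op_iff)

lemma is_inverse_op_commute: "is_inverse_op T S \<longleftrightarrow> is_inverse_op S T"
  by (auto simp: is_inverse_op_def)

lemma invertible_inverse_op: "invertible_op T \<Longrightarrow> invertible_op (inverse_op T)"
  using is_inverse_op_inverse_op is_inverse_op_commute invertible_op_def by blast

lemma inverse_inverse_op: "invertible_op T \<Longrightarrow> inverse_op (inverse_op T) = T"
  using is_inverse_op_inverse_op is_inverse_op_commute inverse_op_eqI by blast

lemma is_inverse_op_scaleR:
  "invertible_op T \<Longrightarrow> r \<noteq> 0 \<Longrightarrow> is_inverse_op (r *\<^sub>R T) ((1 / r) *\<^sub>R inverse_op T)"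
  by (simp add: is_inverse_op_iff blinfun.scaleR_left blinfun.scaleR_right inverse_op_apply)

lemma positive_inverse_op:
  assumes "positive_op T" "invertible_op T"
  shows "positive_op (inverse_op T)"
proof -
  note inv = inverse_op_apply[OF assms(2)]
  note T = positive_opD[OF assms(1)]
  have "complex_linear (inverse_op T)"
    unfolding complex_linear_def using T(1) inv by (metis complex_linear_def)
  moreover have "symmetric_op (inverse_op T)"
    unfolding symmetric_op_def using T(2) inv by (metis symmetric_opD)
  moreover have "0 \<preceq> inverse_op T"
    using T(3) inv unfolding loewner_le_def
    by (metis inner_commute inner_zero_left zero_blinfun.rep_eq)
  ultimately show ?thesis by (simp add: positive_op_iff)
qed

text \<open>The class on which the mean is given by its direct formula. It is stable under inverses,
  congruences and means, so all ALM iterates started in it stay in it.\<close>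

definition pos_inv :: "('a::complex_hilbert_space \<Rightarrow>\<^sub>L 'a) \<Rightarrow> bool" where
  "pos_inv T \<longleftrightarrow> positive_op T \<and> invertible_op T"

lemma pos_invD:
  assumes "pos_inv T"
  shows "positive_op T" "invertible_op T" "complex_linear T" "symmetric_op T" "0 \<preceq> T"
  using assms by (simp_all add: pos_inv_def positive_op_iff)

lemma pos_inv_inverse_op: "pos_inv T \<Longrightarrow> pos_inv (inverse_op T)"
  by (simp add: pos_inv_def positive_inverse_op invertible_inverse_op)

lemma invertible_id: "invertible_op id_blinfun"
  by (auto simp: invertible_op_def is_inverse_op_iff intro!: exI[of _ id_blinfun])

lemma pos_inv_scaleR: "pos_inv T \<Longrightarrow> 0 < r \<Longrightarrow> pos_inv (r *\<^sub>R T)"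
  unfolding pos_inv_def
  using positive_op_scaleR[of T r] is_inverse_op_scaleR[of T r] by (auto simp: invertible_op_def)

lemma pos_inv_scaled_id: "0 < r \<Longrightarrow> pos_inv (r *\<^sub>R id_blinfun)"
  by (intro pos_inv_scaleR) (simp add: pos_inv_def positive_op_id invertible_id)

lemma pos_inv_congruence:
  assumes R: "pos_inv R" and T: "pos_inv T"
  shows "pos_inv (R o\<^sub>L T o\<^sub>L R)"
proof -
  have "is_inverse_op (R o\<^sub>L T o\<^sub>L R) (inverse_op R o\<^sub>L inverse_op T o\<^sub>L inverse_op R)"
    using R T by (simp add: is_inverse_op_iff inverse_op_apply pos_inv_def)
  then show ?thesis
    using assms by (auto simp: pos_inv_def invertible_op_def positive_op_congruence)
qed

text \<open>Writing x as the inverse applied to Tx bounds ||x|| by a multiple of ||Tx||, and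
  \<open>norm_apply_squared_le\<close> bounds ||Tx||^2 by the form of T.\<close>

lemma pos_inv_lower_bound:
  assumes "pos_inv T"
  obtains c where "0 < c" "c *\<^sub>R id_blinfun \<preceq> T"
proof
  let ?S = "inverse_op T"
  \<comment> \<open>The summand 1 keeps \<open>a\<close> positive on the zero space, where both
    norms vanish.\<close>
  define a where "a = (norm ?S)\<^sup>2 * norm T + 1"
  have a: "0 < a" by (simp add: a_def add_nonneg_pos)
  then show "0 < 1 / a" by simp
  have "inner x x \<le> a * inner (T x) x" for x
  proof -
    have p: "0 \<le> inner (T x) x" using pos_invD(5)[OF assms] by (simp add: loewner_le_def)
    have "norm x = norm (?S (T x))" using pos_invD(2)[OF assms] by (simp add: inverse_op_apply)
    also have "\<dots> \<le> norm ?S * norm (T x)" by (rule norm_blinfun)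
    finally have "(norm x)\<^sup>2 \<le> (norm ?S * norm (T x))\<^sup>2" by (rule power_mono) simp
    also have "\<dots> = (norm ?S)\<^sup>2 * (norm (T x))\<^sup>2" by (simp add: power_mult_distrib)
    also have "\<dots> \<le> (norm ?S)\<^sup>2 * (norm T * inner (T x) x)"
      by (intro mult_left_mono norm_apply_squared_le pos_invD[OF assms]) simp
    also have "\<dots> \<le> a * inner (T x) x" using p by (simp add: a_def algebra_simps)
    finally show ?thesis by (simp add: power2_norm_eq_inner)
  qed
  then show "(1 / a) *\<^sub>R id_blinfun \<preceq> T"
    using a by (simp add: loewner_le_def blinfun.scaleR_left divide_le_eq mult.commute)
qed

section \<open>Square roots\<close>

text \<open>$I - Y$ is a square root of $I - E$ iff $Y$ is a fixed point of
  $Y \mapsto (E + Y^2)/2$, which is a contraction on the ball of radius \<open>q\<close>.\<close>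

lemma fixed_point_sqrt:
  fixes E :: "'a::complex_hilbert_space \<Rightarrow>\<^sub>L 'a"
  assumes E: "complex_linear E" "symmetric_op E" "norm E \<le> q" and q: "0 \<le> q" "q < 1"
  obtains Y where "complex_linear Y" "symmetric_op Y" "norm Y \<le> q"
    "(1/2) *\<^sub>R (E + (Y o\<^sub>L Y)) = Y"
proof -
  define V :: "('a \<Rightarrow>\<^sub>L 'a) set"
    where "V = {Y. complex_linear Y \<and> symmetric_op Y \<and> norm Y \<le> q}"
  define f where "f Y = (1/2) *\<^sub>R (E + (Y o\<^sub>L Y))" for Y :: "'a \<Rightarrow>\<^sub>L 'a"
  \<comment> \<open>Each condition is closed in operator norm, so the fixed point of the iteration
    is again complex linear and symmetric.\<close>
  have "V = (\<Inter>c x. {Y :: 'a \<Rightarrow>\<^sub>L 'a. Y (scaleC c x) = scaleC c (Y x)}) \<inter>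
      (\<Inter>x y. {Y :: 'a \<Rightarrow>\<^sub>L 'a. inner (Y x) y = inner x (Y y)}) \<inter> {Y. norm Y \<le> q}"
    by (auto simp: V_def complex_linear_def symmetric_op_def)
  moreover have "closed \<dots>"
    by (intro closed_Int closed_INT ballI closed_Collect_eq closed_Collect_le continuous_intros
        bounded_linear.continuous_on[OF bounded_linear_scaleC] blinfun.continuous_on)
  ultimately have "complete V" by (simp add: complete_eq_closed)
  moreover have "V \<noteq> {}"
    using q complex_linear_zero symmetric_op_zero by (auto simp: V_def intro!: exI[of _ 0])
  moreover have "f ` V \<subseteq> V"
  proof
    fix Z assume "Z \<in> f ` V"
    then obtain Y where Y: "Z = f Y" "complex_linear Y" "symmetric_op Y" "norm Y \<le> q"
      by (auto simp: V_def)
    have "norm (E + (Y o\<^sub>L Y)) \<le> norm E + norm Y * norm Y"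
      by (intro norm_triangle_le add_left_mono norm_blinfun_compose)
    also have "\<dots> \<le> q + q * q" using E(3) Y(4) q by (intro add_mono mult_mono) auto
    also have "\<dots> \<le> q + q * 1" using q by (intro add_left_mono mult_left_mono) auto
    finally have "norm Z \<le> q" by (simp add: Y(1) f_def)
    then show "Z \<in> V"
      using Y E by (simp add: V_def f_def complex_linear_scaleR complex_linear_add
          complex_linear_compose symmetric_op_scaleR symmetric_op_add symmetric_op_square)
  qed
  moreover have "dist (f Y) (f Z) \<le> q * dist Y Z" if "Y \<in> V \<and> Z \<in> V" for Y Z
  proof -
    have n: "norm Y \<le> q" "norm Z \<le> q" using that by (auto simp: V_def)
    \<comment> \<open>Y^2 - Z^2 = Y(Y - Z) + (Y - Z)Z holds without commutation; the factor 1/2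
      turns the bound q + q into q.\<close>
    have "f Y - f Z = (1/2) *\<^sub>R ((Y o\<^sub>L (Y - Z)) + ((Y - Z) o\<^sub>L Z))"
      by (rule blinfun_eqI) (simp add: f_def blinfun.bilinear_simps algebra_simps)
    then have "dist (f Y) (f Z) = (1/2) * norm ((Y o\<^sub>L (Y - Z)) + ((Y - Z) o\<^sub>L Z))"
      by (simp add: dist_norm)
    also have "\<dots> \<le> (1/2) * (norm Y * norm (Y - Z) + norm (Y - Z) * norm Z)"
      by (intro mult_left_mono norm_triangle_le add_mono norm_blinfun_compose) simp
    also have "\<dots> \<le> (1/2) * (q * norm (Y - Z) + norm (Y - Z) * q)"
      using n by (intro mult_left_mono add_mono mult_right_mono) auto
    finally show ?thesis by (simp add: dist_norm)
  qed
  ultimately have "\<exists>!Y\<in>V. f Y = Y" using q by (intro Banach_fix) auto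
  then show ?thesis using that by (auto simp: V_def f_def)
qed

text \<open>Since cI <= T <= KI, the operator E = I - T/K has norm at most q = 1 - c/K < 1. The
  fixed point Y for E then gives the root sqrt(K) (I - Y), positive because ||Y|| <= 1.\<close>

lemma positive_sqrt_exists:
  assumes "pos_inv T"
  obtains S where "positive_op S" "S o\<^sub>L S = T"
proof -
  note T = pos_invD[OF assms]
  obtain c where c: "0 < c" "c *\<^sub>R id_blinfun \<preceq> T" using pos_inv_lower_bound[OF assms] .
  \<comment> \<open>The maximum with \<open>c\<close> secures K > 0 and q >= 0.\<close>
  define K where "K = max c (norm T)"
  have K: "0 < K" "c \<le> K" "norm T \<le> K" using c by (auto simp: K_def)
  have TK: "T \<preceq> K *\<^sub>R id_blinfun"
    by (rule loewner_le_trans[OF loewner_le_norm loewner_le_scaleR_left])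
       (use K in \<open>auto simp: loewner_le_def\<close>)
  define q where "q = 1 - c / K"
  have q: "0 \<le> q" "q < 1" using K c by (simp_all add: q_def)
  define E where "E = id_blinfun - (1 / K) *\<^sub>R T"
  have E1: "complex_linear E" "symmetric_op E"
    unfolding E_def using T by (auto intro!: complex_linear_diff complex_linear_id
        complex_linear_scaleR symmetric_op_diff symmetric_op_id symmetric_op_scaleR)
  have E2: "norm E \<le> q"
  proof (rule norm_le_of_loewner[OF E1(2) q(1)])
    have *: "c * inner x x \<le> inner (T x) x" "inner (T x) x \<le> K * inner x x" for x
      using c(2) TK by (simp_all add: loewner_le_def blinfun.scaleR_left)
    have Ex: "inner (E x) x = inner x x - inner (T x) x / K" for x
      by (simp add: E_def blinfun.bilinear_simps inner_diff_left)
    have "- (q * inner x x) \<le> inner (E x) x" for x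
    proof -
      have "0 \<le> inner (E x) x"
        using *(2)[of x] K by (simp add: Ex divide_le_eq mult.commute)
      moreover have "0 \<le> q * inner x x" using q by simp
      ultimately show ?thesis by linarith
    qed
    then show "- q *\<^sub>R id_blinfun \<preceq> E"
      by (simp add: loewner_le_def blinfun.scaleR_left blinfun.minus_left)
    show "E \<preceq> q *\<^sub>R id_blinfun"
      using *(1) K by (simp add: loewner_le_def Ex q_def blinfun.scaleR_left field_simps)
  qed
  obtain Y where Y: "complex_linear Y" "symmetric_op Y" "norm Y \<le> q"
    "(1/2) *\<^sub>R (E + (Y o\<^sub>L Y)) = Y"
    using fixed_point_sqrt[OF E1 E2 q] .
  \<comment> \<open>The fixed point equation solved for Y^2; it turns (I - Y)^2 into I - E.\<close>
  have Y2: "Y (Y x) = 2 *\<^sub>R Y x - E x" for x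
  proof -
    have "2 *\<^sub>R Y x = 2 *\<^sub>R ((1/2) *\<^sub>R (E + (Y o\<^sub>L Y))) x" using Y(4) by simp
    then show ?thesis by (simp add: blinfun.bilinear_simps algebra_simps)
  qed
  let ?S = "sqrt K *\<^sub>R (id_blinfun - Y)"
  have "Y \<preceq> 1 *\<^sub>R id_blinfun"
    by (rule loewner_le_trans[OF loewner_le_norm loewner_le_scaleR_left])
       (use Y(3) q in \<open>auto simp: loewner_le_def\<close>)
  then have "positive_op (id_blinfun - Y)"
    using Y by (auto simp: positive_op_iff loewner_le_def blinfun.bilinear_simps inner_diff_left
        intro!: complex_linear_diff complex_linear_id symmetric_op_diff symmetric_op_id)
  then have "positive_op ?S" by (rule positive_op_scaleR) (use K in simp)
  moreover have "?S o\<^sub>L ?S = T"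
  proof (rule blinfun_eqI)
    fix x
    have "(?S o\<^sub>L ?S) x = K *\<^sub>R (x - Y x - (Y x - Y (Y x)))"
      using K by (simp add: blinfun.bilinear_simps scaleR_diff_right)
    also have "\<dots> = K *\<^sub>R (x - E x)" by (simp add: Y2 scaleR_2)
    also have "\<dots> = T x" using K by (simp add: E_def blinfun.bilinear_simps)
    finally show "(?S o\<^sub>L ?S) x = T x" .
  qed
  ultimately show ?thesis using that by blast
qed

text \<open>S commutes with the inverse of its square, so their product is a two-sided inverse of
  S.\<close>

lemma pos_inv_sqrtI:
  assumes "positive_op S" "pos_inv (S o\<^sub>L S)"
  shows "pos_inv S"
proof -
  let ?I = "inverse_op (S o\<^sub>L S)"
  have i: "?I (S (S x)) = x" "S (S (?I x)) = x" for x
    using inverse_op_apply[OF pos_invD(2)[OF assms(2)]] by simp_all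
  have "(?I o\<^sub>L S) x = (S o\<^sub>L ?I) x" for x
    by simp (metis i)
  then have "is_inverse_op S (S o\<^sub>L ?I)" using i by (simp add: is_inverse_op_iff)
  then show ?thesis using assms by (auto simp: pos_inv_def invertible_op_def)
qed

lemma sqrt_mono:
  assumes "positive_op S" "pos_inv T" "S o\<^sub>L S \<preceq> T o\<^sub>L T"
  shows "S \<preceq> T"
  using pos_inv_lower_bound[OF assms(2)] loewner_le_of_square_le[OF _ _ _ _ _ assms(3)]
    positive_opD[OF assms(1)] pos_invD[OF assms(2)] by blast

text \<open>Uniqueness comes from monotonicity: two positive roots of T have comparable squares in
  both directions, hence are equal by antisymmetry.\<close>

lemma sqrt_op_eqI:
  assumes "positive_op S" "S o\<^sub>L S = T" "pos_inv T"
  shows "sqrt_op T = S"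
  unfolding sqrt_op_def
proof (rule the_equality)
  show "positive_op S \<and> S o\<^sub>L S = T" using assms by simp
  fix R assume R: "positive_op R \<and> R o\<^sub>L R = T"
  have RS: "pos_inv R" "pos_inv S" "R o\<^sub>L R = S o\<^sub>L S"
    using assms R by (auto intro: pos_inv_sqrtI)
  show "R = S"
  proof (rule loewner_antisym)
    show "R \<preceq> S" "S \<preceq> R"
      using sqrt_mono[of R S] sqrt_mono[of S R] RS by (simp_all add: pos_invD(1) loewner_le_refl)
  qed (use RS in \<open>simp_all add: pos_invD\<close>)
qed

lemma sqrt_op:
  assumes "pos_inv T"
  shows "pos_inv (sqrt_op T)" "sqrt_op T o\<^sub>L sqrt_op T = T"
proof -
  obtain S where "positive_op S" "S o\<^sub>L S = T" using positive_sqrt_exists[OF assms] .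
  then show "pos_inv (sqrt_op T)" "sqrt_op T o\<^sub>L sqrt_op T = T"
    using sqrt_op_eqI[of S T] assms pos_inv_sqrtI[of S] by auto
qed

section \<open>The geometric mean of positive invertible operators\<close>

text \<open>With R the root of A and D the middle factor, the inverse of A is the square of the
  inverse of R. It cancels the inner factors R, the two roots of D combine to D, and RDR =
  B.\<close>

lemma geometric_mean_pos_inv:
  assumes A: "pos_inv A" and B: "pos_inv B"
  shows "pos_inv (A \<sharp> B)" and "(A \<sharp> B) o\<^sub>L inverse_op A o\<^sub>L (A \<sharp> B) = B"
proof -
  define R where "R = sqrt_op A"
  define D where "D = inverse_op R o\<^sub>L B o\<^sub>L inverse_op R"
  have R: "pos_inv R" "R o\<^sub>L R = A" using sqrt_op[OF A] by (simp_all add: R_def)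
  have D: "pos_inv D" unfolding D_def by (intro pos_inv_congruence pos_inv_inverse_op R B)
  have G: "A \<sharp> B = R o\<^sub>L sqrt_op D o\<^sub>L R"
    using A by (simp add: geometric_mean_def geometric_mean_inv_def pos_inv_def R_def D_def Let_def)
  show "pos_inv (A \<sharp> B)" unfolding G by (intro pos_inv_congruence R sqrt_op D)
  have i: "inverse_op R (R x) = x" "R (inverse_op R x) = x" for x
    using inverse_op_apply pos_invD(2)[OF R(1)] by auto
  have "is_inverse_op A (inverse_op R o\<^sub>L inverse_op R)"
    by (simp add: is_inverse_op_iff i R(2)[symmetric])
  then have A': "inverse_op A = inverse_op R o\<^sub>L inverse_op R" by (rule inverse_op_eqI)
  have s: "sqrt_op D (sqrt_op D x) = D x" for x
    using sqrt_op(2)[OF D] by (metis blinfun_apply_blinfun_compose)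
  show "(A \<sharp> B) o\<^sub>L inverse_op A o\<^sub>L (A \<sharp> B) = B"
    \<comment> \<open>\<open>D\<close> stays folded in the first pass so that \<open>s\<close> can
      merge the two roots; only then is it unfolded.\<close>
    by (rule blinfun_eqI) (simp add: G A' i s, simp add: D_def i)
qed

text \<open>Congruence by the inverse of R, the root of A, turns the Riccati expression of G into
  the square of the congruent copy of G. \<open>sqrt_mono\<close> compares these copies, and
  congruence by R returns to G and H.\<close>

lemma geometric_mean_mono:
  assumes A: "pos_inv A" and G: "pos_inv G" and H: "pos_inv H"
    and le: "G o\<^sub>L inverse_op A o\<^sub>L G \<preceq> H o\<^sub>L inverse_op A o\<^sub>L H"
  shows "G \<preceq> H"
proof -
  define R where "R = sqrt_op A"
  let ?R' = "inverse_op R"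
  have R: "pos_inv R" "R o\<^sub>L R = A" using sqrt_op[OF A] by (simp_all add: R_def)
  have R': "pos_inv ?R'" by (rule pos_inv_inverse_op[OF R(1)])
  have i: "?R' (R x) = x" "R (?R' x) = x" for x
    using inverse_op_apply pos_invD(2)[OF R(1)] by auto
  have "is_inverse_op A (?R' o\<^sub>L ?R')"
    by (simp add: is_inverse_op_iff i R(2)[symmetric])
  then have A': "inverse_op A = ?R' o\<^sub>L ?R'" by (rule inverse_op_eqI)
  let ?g = "?R' o\<^sub>L G o\<^sub>L ?R'" and ?h = "?R' o\<^sub>L H o\<^sub>L ?R'"
  have sq: "(?R' o\<^sub>L X o\<^sub>L ?R') o\<^sub>L (?R' o\<^sub>L X o\<^sub>L ?R') =
      ?R' o\<^sub>L (X o\<^sub>L inverse_op A o\<^sub>L X) o\<^sub>L ?R'" for X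
    by (rule blinfun_eqI) (simp add: A')
  have "?g \<preceq> ?h"
  proof (rule sqrt_mono)
    show "positive_op ?g" "pos_inv ?h"
      by (intro pos_invD(1) pos_inv_congruence R' G H)+
    show "?g o\<^sub>L ?g \<preceq> ?h o\<^sub>L ?h"
      unfolding sq by (rule loewner_le_congruence[OF pos_invD(4)[OF R'] le])
  qed
  from loewner_le_congruence[OF pos_invD(4)[OF R(1)] this]
  have "R o\<^sub>L ?g o\<^sub>L R \<preceq> R o\<^sub>L ?h o\<^sub>L R" .
  moreover have "R o\<^sub>L (?R' o\<^sub>L X o\<^sub>L ?R') o\<^sub>L R = X" for X
    by (rule blinfun_eqI) (simp add: i)
  ultimately show ?thesis by simp
qed

lemma geometric_mean_eqI:
  assumes A: "pos_inv A" and G: "pos_inv G" and eq: "G o\<^sub>L inverse_op A o\<^sub>L G = B"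
  shows "A \<sharp> B = G"
proof -
  have B: "pos_inv B"
    unfolding eq[symmetric] by (intro pos_inv_congruence pos_inv_inverse_op A G)
  note M = geometric_mean_pos_inv[OF A B]
  have "A \<sharp> B \<preceq> G" "G \<preceq> A \<sharp> B"
    using geometric_mean_mono[OF A M(1) G] geometric_mean_mono[OF A G M(1)] M(2) eq
    by (simp_all add: loewner_le_refl)
  then show ?thesis by (rule loewner_antisym[OF pos_invD(4)[OF M(1)] pos_invD(4)[OF G]])
qed

section \<open>Monotonicity, self-duality, symmetry and homogeneity\<close>

lemma geometric_mean_mono_right:
  assumes "pos_inv A" "pos_inv B" "pos_inv C" "B \<preceq> C"
  shows "A \<sharp> B \<preceq> A \<sharp> C"
  using assms
  by (simp add: geometric_mean_mono[OF assms(1)] geometric_mean_pos_inv)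

text \<open>Obtained by inverting both sides of the Riccati equation. Read for the inverses of A and
  B, it is their Riccati equation; solved for A, it is the one with A and B exchanged.\<close>

lemma riccati_inverse:
  assumes "pos_inv A" "pos_inv B"
  shows "inverse_op (A \<sharp> B) o\<^sub>L A o\<^sub>L inverse_op (A \<sharp> B) = inverse_op B"
proof -
  note M = geometric_mean_pos_inv[OF assms]
  let ?G' = "inverse_op (A \<sharp> B)"
  have i: "inverse_op A (A x) = x" "A (inverse_op A x) = x" for x
    using inverse_op_apply assms(1) by (auto simp: pos_inv_def)
  have g: "?G' ((A \<sharp> B) x) = x" "(A \<sharp> B) (?G' x) = x" for x
    using inverse_op_apply pos_invD(2)[OF M(1)] by auto
  have "B x = (A \<sharp> B) (inverse_op A ((A \<sharp> B) x))" for x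
    by (subst M(2)[symmetric]) simp
  then have "is_inverse_op B (?G' o\<^sub>L A o\<^sub>L ?G')"
    by (simp add: is_inverse_op_iff i g)
  then show ?thesis by (simp add: inverse_op_eqI)
qed

lemma geometric_mean_inverse:
  assumes "pos_inv A" "pos_inv B"
  shows "inverse_op A \<sharp> inverse_op B = inverse_op (A \<sharp> B)"
  using assms geometric_mean_pos_inv[OF assms] riccati_inverse[OF assms]
  by (intro geometric_mean_eqI pos_inv_inverse_op) (simp_all add: inverse_inverse_op pos_inv_def)

lemma geometric_mean_commute:
  assumes "pos_inv A" "pos_inv B"
  shows "A \<sharp> B = B \<sharp> A"
proof (rule geometric_mean_eqI[symmetric, OF assms(2)])
  note M = geometric_mean_pos_inv[OF assms]
  show "pos_inv (A \<sharp> B)" by (rule M)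
  show "(A \<sharp> B) o\<^sub>L inverse_op B o\<^sub>L (A \<sharp> B) = A"
    by (rule blinfun_eqI)
       (simp add: riccati_inverse[OF assms, symmetric] inverse_op_apply[OF pos_invD(2)[OF M(1)]])
qed

lemma geometric_mean_idem: "pos_inv A \<Longrightarrow> A \<sharp> A = A"
  by (rule geometric_mean_eqI) (auto intro!: blinfun_eqI simp: inverse_op_apply pos_inv_def)

lemma geometric_mean_scaleR_right:
  assumes A: "pos_inv A" and B: "pos_inv B" and r: "0 < r"
  shows "A \<sharp> (r *\<^sub>R B) = sqrt r *\<^sub>R (A \<sharp> B)"
proof (rule geometric_mean_eqI[OF A])
  note M = geometric_mean_pos_inv[OF A B]
  show "pos_inv (sqrt r *\<^sub>R (A \<sharp> B))" using M(1) r by (simp add: pos_inv_scaleR)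
  have "B x = (A \<sharp> B) (inverse_op A ((A \<sharp> B) x))" for x
    by (subst M(2)[symmetric]) simp
  then show "sqrt r *\<^sub>R (A \<sharp> B) o\<^sub>L inverse_op A o\<^sub>L sqrt r *\<^sub>R (A \<sharp> B) = r *\<^sub>R B"
    using r by (intro blinfun_eqI) (simp add: blinfun.bilinear_simps)
qed

section \<open>Joint monotonicity and contraction estimates\<close>

lemma geometric_mean_mono2:
  assumes "pos_inv A" "pos_inv B" "pos_inv A'" "pos_inv B'" "A \<preceq> A'" "B \<preceq> B'"
  shows "A \<sharp> B \<preceq> A' \<sharp> B'"
proof -
  have "A \<sharp> B \<preceq> A \<sharp> B'" using assms by (intro geometric_mean_mono_right)
  also have "\<dots> = B' \<sharp> A" using assms by (intro geometric_mean_commute)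
  also have "\<dots> \<preceq> B' \<sharp> A'" using assms by (intro geometric_mean_mono_right)
  also have "\<dots> = A' \<sharp> B'" using assms by (intro geometric_mean_commute)
  finally show ?thesis .
qed

text \<open>With a shared first argument, homogeneity of degree 1/2 in the second yields the factor
  sqrt(1 + e), which is at most 1 + e/2. This is the source of the halving.\<close>

lemma geometric_mean_contract_right:
  assumes A: "pos_inv A" and B: "pos_inv B" and C: "pos_inv C" and e: "0 \<le> e"
    and le: "B \<preceq> (1 + e) *\<^sub>R C"
  shows "A \<sharp> B \<preceq> (1 + e / 2) *\<^sub>R (A \<sharp> C)"
proof -
  have "A \<sharp> B \<preceq> A \<sharp> ((1 + e) *\<^sub>R C)"
    using A B C e le by (intro geometric_mean_mono_right pos_inv_scaleR) auto
  also have "\<dots> = sqrt (1 + e) *\<^sub>R (A \<sharp> C)"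
    using A C e by (intro geometric_mean_scaleR_right) auto
  also have "\<dots> \<preceq> (1 + e / 2) *\<^sub>R (A \<sharp> C)"
  proof (rule loewner_le_scaleR_left)
    show "0 \<preceq> A \<sharp> C" using geometric_mean_pos_inv[OF A C] by (simp add: pos_invD)
    show "sqrt (1 + e) \<le> 1 + e / 2"
      using e by (intro real_le_lsqrt) (auto simp: power2_eq_square algebra_simps)
  qed
  finally show ?thesis .
qed

text \<open>A common upper bound of A and B is its own mean, so joint monotonicity applies. Together
  with the next lemma this compares an iterate with its successor.\<close>

lemma geometric_mean_le_scaleR:
  assumes A: "pos_inv A" and B: "pos_inv B" and C: "pos_inv C" and e: "0 \<le> e"
    and le: "A \<preceq> (1 + e) *\<^sub>R C" "B \<preceq> (1 + e) *\<^sub>R C"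
  shows "A \<sharp> B \<preceq> (1 + e) *\<^sub>R C"
proof -
  have "pos_inv ((1 + e) *\<^sub>R C)" using C e by (simp add: pos_inv_scaleR)
  then show ?thesis
    using geometric_mean_mono2[OF A B _ _ le] by (simp add: geometric_mean_idem)
qed

lemma scaleR_le_geometric_mean:
  assumes A: "pos_inv A" and B: "pos_inv B" and C: "pos_inv C" and e: "0 \<le> e"
    and le: "C \<preceq> (1 + e) *\<^sub>R A" "C \<preceq> (1 + e) *\<^sub>R B"
  shows "C \<preceq> (1 + e) *\<^sub>R (A \<sharp> B)"
proof -
  \<comment> \<open>After division by 1 + e, \<open>C\<close> is a common lower bound of
    \<open>A\<close> and \<open>B\<close>.\<close>
  have C': "pos_inv ((1 / (1 + e)) *\<^sub>R C)" using C e by (simp add: pos_inv_scaleR)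
  have "(1 / (1 + e)) *\<^sub>R C \<preceq> X" if "C \<preceq> (1 + e) *\<^sub>R X" for X
    using loewner_le_scaleR[OF that, of "1 / (1 + e)"] e by simp
  then have "(1 / (1 + e)) *\<^sub>R C \<preceq> A \<sharp> B"
    using geometric_mean_mono2[OF C' C' A B] le by (simp add: geometric_mean_idem C')
  from loewner_le_scaleR[OF this, of "1 + e"] show ?thesis using e by simp
qed

section \<open>Convergence of the ALM procedure\<close>

text \<open>For e >= 0 the mutual bounds say that the pairwise Thompson distances are at most log (1
  + e). The bound by K converts such multiplicative closeness into closeness in norm.\<close>

definition alm_close :: "real \<Rightarrow> real \<Rightarrow>
    ('a::complex_hilbert_space \<Rightarrow>\<^sub>L 'a) \<times> ('a \<Rightarrow>\<^sub>L 'a) \<times> ('a \<Rightarrow>\<^sub>L 'a) \<Rightarrow> bool" where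
  "alm_close K e = (\<lambda>(X, Y, Z).
     (\<forall>S\<in>{X, Y, Z}. pos_inv S \<and> S \<preceq> K *\<^sub>R id_blinfun \<and>
        (\<forall>T\<in>{X, Y, Z}. S \<preceq> (1 + e) *\<^sub>R T)))"

lemma alm_close_step:
  assumes "alm_close K e (X, Y, Z)" "0 \<le> e" "0 < K"
  shows "alm_close K (e / 2) (Y \<sharp> Z, Z \<sharp> X, X \<sharp> Y)"
proof -
  have p: "pos_inv X" "pos_inv Y" "pos_inv Z"
    and le: "\<And>S T. S \<in> {X, Y, Z} \<Longrightarrow> T \<in> {X, Y, Z} \<Longrightarrow> S \<preceq> (1 + e) *\<^sub>R T"
    and K: "\<And>S. S \<in> {X, Y, Z} \<Longrightarrow> S \<preceq> K *\<^sub>R id_blinfun"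
    using assms(1) by (auto simp: alm_close_def)
  have PK: "pos_inv (K *\<^sub>R id_blinfun)" using assms by (intro pos_inv_scaled_id)
  \<comment> \<open>The bound survives because the mean of KI with itself is KI.\<close>
  have bd: "S \<sharp> T \<preceq> K *\<^sub>R id_blinfun" if "S \<in> {X, Y, Z}" "T \<in> {X, Y, Z}" for S T
    using geometric_mean_mono2[OF _ _ PK PK K[OF that(1)] K[OF that(2)]] p that
    by (auto simp: geometric_mean_idem PK)
  have self: "S \<preceq> (1 + e / 2) *\<^sub>R S" if "pos_inv S" for S
    using loewner_le_scaleR_left[OF pos_invD(5)[OF that], of 1 "1 + e / 2"] assms(2) by simp
  note cr = geometric_mean_contract_right[OF _ _ _ assms(2)]
  \<comment> \<open>Any two of the three new operators share an argument \<open>T\<close>. Symmetry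
    moves it to the first place, where the contraction estimate applies in both directions.\<close>
  have c: "S \<sharp> T \<preceq> (1 + e / 2) *\<^sub>R (T \<sharp> U) \<and> T \<sharp> U \<preceq> (1 + e / 2) *\<^sub>R (S \<sharp> T)"
    if "S \<in> {X, Y, Z}" "T \<in> {X, Y, Z}" "U \<in> {X, Y, Z}" for S T U
  proof -
    have P: "pos_inv S" "pos_inv T" "pos_inv U" using p that by auto
    then show ?thesis
      using cr[OF P(2,1,3) le[OF that(1,3)]] cr[OF P(2,3,1) le[OF that(3,1)]]
        geometric_mean_commute[OF P(1,2)] by simp
  qed
  show ?thesis
    unfolding alm_close_def
    using p bd c[of Y Z X] c[of Z X Y] c[of X Y Z]
      self[of "Y \<sharp> Z"] self[of "Z \<sharp> X"] self[of "X \<sharp> Y"]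
    by (simp add: geometric_mean_pos_inv)
qed

lemma alm_close_seq:
  assumes "alm_close K e (A, B, C)" "0 \<le> e" "0 < K"
  shows "alm_close K (e / 2 ^ n) (alm_seq A B C n)"
proof (induction n)
  case 0
  then show ?case using assms by simp
next
  case (Suc n)
  obtain X Y Z where eq: "alm_seq A B C n = (X, Y, Z)" by (cases "alm_seq A B C n")
  show ?case
    using alm_close_step[of K "e / 2 ^ n" X Y Z] Suc assms
    by (simp add: eq divide_divide_eq_left mult.commute)
qed

text \<open>S - T <= eT <= eKI, and likewise with S and T exchanged.\<close>

lemma norm_diff_le:
  assumes "pos_inv S" "pos_inv T" "0 \<le> e" "0 < K"
    and "S \<preceq> K *\<^sub>R id_blinfun" "T \<preceq> K *\<^sub>R id_blinfun"
    and "S \<preceq> (1 + e) *\<^sub>R T" "T \<preceq> (1 + e) *\<^sub>R S"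
  shows "norm (S - T) \<le> e * K"
proof -
  have *: "inner (S x) x \<le> inner (T x) x + e * K * inner x x"
    if "S \<preceq> (1 + e) *\<^sub>R T" "T \<preceq> K *\<^sub>R id_blinfun" for S T :: "'a \<Rightarrow>\<^sub>L 'a" and x
  proof -
    have "inner (S x) x \<le> (1 + e) * inner (T x) x" "inner (T x) x \<le> K * inner x x"
      using that by (auto simp: loewner_le_def blinfun.scaleR_left)
    moreover from this(2) have "e * inner (T x) x \<le> e * (K * inner x x)"
      using assms(3) by (rule mult_left_mono)
    ultimately show ?thesis by (simp add: algebra_simps)
  qed
  show ?thesis
  proof (rule norm_le_of_loewner)
    show "symmetric_op (S - T)" using assms by (simp add: symmetric_op_diff pos_invD)
    show "0 \<le> e * K" using assms by simp
    show "- (e * K) *\<^sub>R id_blinfun \<preceq> S - T" "S - T \<preceq> (e * K) *\<^sub>R id_blinfun"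
      using *[OF assms(7,6)] *[OF assms(8,5)]
      by (simp_all add: loewner_le_def blinfun.bilinear_simps inner_diff_left algebra_simps)
  qed
qed

lemma convergent_of_geometric_steps:
  fixes f :: "nat \<Rightarrow> 'a::banach"
  assumes "\<And>n. norm (f (Suc n) - f n) \<le> c / 2 ^ n"
  shows "convergent f"
proof -
  have "summable (\<lambda>n. f (Suc n) - f n)"
  proof (rule summable_comparison_test')
    show "summable (\<lambda>n. c * (1 / 2) ^ n)" by (intro summable_mult summable_geometric) simp
    show "norm (f (Suc n) - f n) \<le> c * (1 / 2) ^ n" if "0 \<le> n" for n
      using assms[of n] by (simp add: power_divide)
  qed
  then have "convergent (\<lambda>n. f n - f 0)"
    by (simp add: summable_iff_convergent sum_lessThan_telescope)
  then have "convergent (\<lambda>n. f n - f 0 + f 0)" by (intro convergent_add convergent_const)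
  then show ?thesis by simp
qed

lemma alm_close_initial:
  assumes "pos_inv A" "pos_inv B" "pos_inv C"
  obtains K e where "0 < K" "0 \<le> e" "alm_close K e (A, B, C)"
proof -
  obtain a b c where abc: "0 < a" "a *\<^sub>R id_blinfun \<preceq> A" "0 < b" "b *\<^sub>R id_blinfun \<preceq> B"
    "0 < c" "c *\<^sub>R id_blinfun \<preceq> C"
    using pos_inv_lower_bound assms by metis
  define k where "k = min a (min b c)"
  \<comment> \<open>Including \<open>k\<close> in the maximum gives k <= K, hence a nonnegative
    initial e = K/k - 1.\<close>
  define K where "K = max k (max (norm A) (max (norm B) (norm C)))"
  have k: "0 < k" "k \<le> a" "k \<le> b" "k \<le> c" using abc by (auto simp: k_def)
  have K: "k \<le> K" "norm A \<le> K" "norm B \<le> K" "norm C \<le> K" by (auto simp: K_def)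
  have id0: "0 \<preceq> (id_blinfun :: 'a \<Rightarrow>\<^sub>L 'a)" by (simp add: loewner_le_def)
  have low: "\<forall>S\<in>{A, B, C}. k *\<^sub>R id_blinfun \<preceq> S"
    using abc k loewner_le_scaleR_left[OF id0] loewner_le_trans by blast
  have up: "\<forall>S\<in>{A, B, C}. S \<preceq> K *\<^sub>R id_blinfun"
    using K loewner_le_scaleR_left[OF id0] loewner_le_trans loewner_le_norm by blast
  \<comment> \<open>The chain S <= KI = (K/k) kI <= (K/k) T passes through multiples of the
    identity.\<close>
  have "S \<preceq> (1 + (K / k - 1)) *\<^sub>R T" if "S \<in> {A, B, C}" "T \<in> {A, B, C}" for S T
  proof -
    have "S \<preceq> (K / k) *\<^sub>R (k *\<^sub>R id_blinfun)" using up that k by auto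
    also have "\<dots> \<preceq> (K / k) *\<^sub>R T"
      by (rule loewner_le_scaleR) (use low that k K in auto)
    finally show ?thesis by simp
  qed
  then have "alm_close K (K / k - 1) (A, B, C)"
    using assms up unfolding alm_close_def by blast
  moreover have "0 < K" "0 \<le> K / k - 1" using k K by (auto simp: field_simps)
  ultimately show ?thesis using that by blast
qed

lemma alm_seq_pos_inv:
  assumes "pos_inv A" "pos_inv B" "pos_inv C"
  shows "case alm_seq A B C n of (X, Y, Z) \<Rightarrow> pos_inv X \<and> pos_inv Y \<and> pos_inv Z"
  by (induction n) (use assms in \<open>auto simp: geometric_mean_pos_inv split: prod.splits\<close>)

lemma alm_seq_tendsto:
  assumes "pos_inv A" "pos_inv B" "pos_inv C"
  obtains M where "(\<lambda>n. fst (alm_seq A B C n)) \<longlonglongrightarrow> M"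
    "(\<lambda>n. fst (snd (alm_seq A B C n))) \<longlonglongrightarrow> M" "(\<lambda>n. snd (snd (alm_seq A B C n))) \<longlonglongrightarrow> M"
proof -
  obtain K e where K: "0 < K" and e: "0 \<le> e" and ini: "alm_close K e (A, B, C)"
    using alm_close_initial[OF assms] .
  define x where "x n = fst (alm_seq A B C n)" for n
  define y where "y n = fst (snd (alm_seq A B C n))" for n
  define z where "z n = snd (snd (alm_seq A B C n))" for n
  have seq: "alm_seq A B C n = (x n, y n, z n)" for n by (simp add: x_def y_def z_def)
  have cl: "alm_close K (e / 2 ^ n) (x n, y n, z n)" for n
    using alm_close_seq[OF ini e K, of n] by (simp add: seq)
  have xS: "x (Suc n) = y n \<sharp> z n" for n by (simp add: x_def y_def z_def case_prod_beta)
  have en: "0 \<le> e / 2 ^ n" for n using e by simp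
  have yx: "norm (y n - x n) \<le> e * K / 2 ^ n" and zx: "norm (z n - x n) \<le> e * K / 2 ^ n" for n
    using cl[of n] norm_diff_le[OF _ _ en K, of "y n" "x n" n]
      norm_diff_le[OF _ _ en K, of "z n" "x n" n] by (simp_all add: alm_close_def)
  \<comment> \<open>The successor is the mean of \<open>y n\<close> and \<open>z n\<close>, both
    comparable with \<open>x n\<close> up to the factor 1 + e/2^n, so it inherits this
    comparison.\<close>
  have "norm (x (Suc n) - x n) \<le> e * K / 2 ^ n" for n
  proof -
    have "norm (x (Suc n) - x n) \<le> e / 2 ^ n * K"
    proof (rule norm_diff_le[OF _ _ en K])
      show "x (Suc n) \<preceq> K *\<^sub>R id_blinfun" "pos_inv (x (Suc n))"
        using cl[of "Suc n"] by (simp_all add: alm_close_def)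
      show "x (Suc n) \<preceq> (1 + e / 2 ^ n) *\<^sub>R x n"
        unfolding xS by (rule geometric_mean_le_scaleR) (use cl[of n] en in \<open>simp_all add: alm_close_def\<close>)
      show "x n \<preceq> (1 + e / 2 ^ n) *\<^sub>R x (Suc n)"
        unfolding xS by (rule scaleR_le_geometric_mean) (use cl[of n] en in \<open>simp_all add: alm_close_def\<close>)
    qed (use cl[of n] in \<open>simp_all add: alm_close_def\<close>)
    then show ?thesis by simp
  qed
  then have "convergent x" by (rule convergent_of_geometric_steps)
  then obtain M where M: "x \<longlonglongrightarrow> M" by (auto simp: convergent_def)
  have z0: "(\<lambda>n. e * K / 2 ^ n) \<longlonglongrightarrow> 0"
    using tendsto_mult_right_zero[OF LIMSEQ_power_zero[of "1/2::real"], of "e * K"]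
    by (simp add: power_divide)
  \<comment> \<open>Only \<open>x\<close> needs a Cauchy argument; the other two sequences approach
    it geometrically.\<close>
  have close: "w \<longlonglongrightarrow> M" if "\<And>n. norm (w n - x n) \<le> e * K / 2 ^ n" for w
  proof -
    have "(\<lambda>n. w n - x n) \<longlonglongrightarrow> 0"
      by (rule Lim_null_comparison[OF _ z0]) (simp add: that)
    from tendsto_add[OF this M] show ?thesis by simp
  qed
  show ?thesis
    using that[of M] M close[OF yx] close[OF zx] by (simp add: x_def[abs_def] y_def[abs_def] z_def[abs_def])
qed

section \<open>Weak limits and the ALM mean\<close>

lemma weak_limit_of_norm_limit:
  fixes f :: "nat \<Rightarrow> 'a::complex_hilbert_space \<Rightarrow>\<^sub>L 'a"
  assumes "f \<longlonglongrightarrow> M"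
  shows "limitin weak_operator_topology f M sequentially"
  unfolding limitin_weak_operator_topology cinner_eq_inner
  by (intro allI tendsto_Complex tendsto_inner tendsto_const blinfun.tendsto assms)

lemma weak_limit_unique:
  assumes "limitin weak_operator_topology f M sequentially"
    "limitin weak_operator_topology f N sequentially"
  shows "M = N"
proof (rule blinfun_eqI)
  fix x
  have "cinner (M x) y = cinner (N x) y" for y
    using assms LIMSEQ_unique unfolding limitin_weak_operator_topology by blast
  then have "inner (M x - N x) y = 0" for y
    unfolding inner_diff_left by (simp add: inner_eq_Re_cinner)
  then show "M x = N x" by (metis inner_eq_zero_iff right_minus_eq)
qed

text \<open>A norm limit is a weak limit, and weak limits are unique, so the definite description in
  \<open>alm_mean\<close> selects M.\<close>

lemma alm_mean_eqI:
  assumes "(\<lambda>n. fst (alm_seq A B C n)) \<longlonglongrightarrow> M"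
    "(\<lambda>n. fst (snd (alm_seq A B C n))) \<longlonglongrightarrow> M" "(\<lambda>n. snd (snd (alm_seq A B C n))) \<longlonglongrightarrow> M"
  shows "alm_mean A B C = M"
  unfolding alm_mean_def
  using assms by (intro the_equality conjI weak_limit_of_norm_limit) (auto intro: weak_limit_unique weak_limit_of_norm_limit)

section \<open>Inverses of the ALM iterates and of their limit\<close>

lemma alm_seq_inverse:
  assumes "pos_inv A" "pos_inv B" "pos_inv C"
  shows "alm_seq (inverse_op A) (inverse_op B) (inverse_op C) n =
    map_prod inverse_op (map_prod inverse_op inverse_op) (alm_seq A B C n)"
proof (induction n)
  case (Suc n)
  then show ?case
    using alm_seq_pos_inv[OF assms, of n]
    by (auto simp: geometric_mean_inverse split: prod.splits)
qed simp

lemma alm_mean_inverse: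
  assumes A: "pos_inv A" and B: "pos_inv B" and C: "pos_inv C"
  shows "is_inverse_op (alm_mean (inverse_op A) (inverse_op B) (inverse_op C)) (alm_mean A B C)"
proof -
  obtain M where M: "(\<lambda>n. fst (alm_seq A B C n)) \<longlonglongrightarrow> M"
    and M': "alm_mean A B C = M"
    using alm_seq_tendsto[OF A B C] alm_mean_eqI by metis
  obtain N where N: "(\<lambda>n. fst (alm_seq (inverse_op A) (inverse_op B) (inverse_op C) n)) \<longlonglongrightarrow> N"
    and N': "alm_mean (inverse_op A) (inverse_op B) (inverse_op C) = N"
    using alm_seq_tendsto[OF A[THEN pos_inv_inverse_op] B[THEN pos_inv_inverse_op]
        C[THEN pos_inv_inverse_op]] alm_mean_eqI by metis
  have N2: "(\<lambda>n. inverse_op (fst (alm_seq A B C n))) \<longlonglongrightarrow> N"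
    using N by (simp add: alm_seq_inverse[OF A B C])
  have inv: "is_inverse_op (fst (alm_seq A B C n)) (inverse_op (fst (alm_seq A B C n)))" for n
    using alm_seq_pos_inv[OF A B C, of n]
    by (auto intro!: is_inverse_op_inverse_op simp: pos_inv_def split: prod.splits)
  \<comment> \<open>Composition is jointly continuous in norm. In either order the products form the
    constant sequence I, so the limits are two-sided inverses of each other.\<close>
  note lim = bounded_bilinear.tendsto[OF bounded_bilinear_blinfun_compose]
  have "M o\<^sub>L N = id_blinfun" "N o\<^sub>L M = id_blinfun"
    using lim[OF M N2] lim[OF N2 M] inv by (auto simp: is_inverse_op_def LIMSEQ_const_iff)
  then show ?thesis by (simp add: M' N' is_inverse_op_def)
qed

theorem proposition5p3:
  shows "is_adjoint_mean
    (alm_mean :: ('a::complex_hilbert_space \<Rightarrow>\<^sub>L 'a) \<Rightarrow> ('a \<Rightarrow>\<^sub>L 'a) \<Rightarrow> ('a \<Rightarrow>\<^sub>L 'a) \<Rightarrow> ('a \<Rightarrow>\<^sub>L 'a))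
    alm_mean"
  unfolding is_adjoint_mean_def
proof (intro allI impI)
  fix A B C :: "'a \<Rightarrow>\<^sub>L 'a"
  assume "positive_op A \<and> invertible_op A \<and> positive_op B \<and> invertible_op B \<and>
    positive_op C \<and> invertible_op C"
  then have inv: "is_inverse_op (alm_mean (inverse_op A) (inverse_op B) (inverse_op C))
      (alm_mean A B C)"
    by (intro alm_mean_inverse) (simp_all add: pos_inv_def)
  then show "invertible_op (alm_mean (inverse_op A) (inverse_op B) (inverse_op C)) \<and>
    alm_mean A B C = inverse_op (alm_mean (inverse_op A) (inverse_op B) (inverse_op C))"
    using inverse_op_eqI[OF inv] by (auto simp: invertible_op_def)
qed

end
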